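(* Let $S=\{s_i^l\mid i\in\{1,\dots,F\},\ l\in\{1,\dots,L\}\}$ be a set of $FL$ distinct elements, $S_i=\{s_i^l\mid 1\le l\le L\}$, and for $C\subseteq S$ put $C_i=C\cap S_i$. Then the set function on subsets $C\subseteq S$ $$C\ \longmapsto\ -\sum_{i=1}^{F} f_i\sum_{n=0}^{\infty}p_n\sum_{(d_i^1,\dots,d_i^n)\in\{0,\dots,L\}^n}\Big(\prod_{k=1}^n p_{d_i^k}\Big)\, D(C_i,u),$$ where $$D(C_i,u)=\Big(L-|C_i|-\sum_{k=1}^{n}\min\Big\{d_i^k,\Big\lfloor \frac{L}{\mu}\mathcal R(u)\Big\rfloor\Big\}\Big)^+,\qquad u=\big|\{k\in\{1,\dots,n\}: d_i^k\neq 0\}\big|,$$ is submodular.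
   Context: $F,L\ge1$ are integers and $(x)^+=\max\{0,x\}$. $f_i=i^{-\gamma}/\sum_{j=1}^F j^{-\gamma}$ is the Zipf probability that content $i$ is requested, with exponent $\gamma\ge 0$. $p_n=\left(\frac{\eta\lambda}{\mu}\right)^n\frac{e^{-\eta\lambda/\mu}}{n!}$ is the probability that $n$ neighboring users are present, where $\lambda,\mu>0$ and $\eta\in[0,1]$. For each content $i$ and neighboring user $k$, $d_i^k\in\{0,\dots,L\}$ is the number of packets of content $i$ stored by user $k$, and $p_{d_i^k}$ is the probability of this value, under an arbitrary probability distribution on $\{0,\dots,L\}$ (possibly depending on $i$), independent and identical among the neighboring users $k$. The number $u$ counts the neighboring users holding at least one packet of content $i$ (the transmitting users). For $u\ge1$, $\mathcal R(u)\ge 0$ is the average achievable rate, either $\mathcal R(u)=\frac1u\mathbb P[\rho>\tau\mid u=1]\log(1+\tau)$ (orthogonal multiple access) or $\mathcal R(u)=\mathbb P[\rho>\tau\mid u]\log(1+\tau)$ (non-orthogonal multiple access), with $\tau>0$ and $\mathbb P[\rho>\tau\mid u]\in[0,1]$ the probability of a successful packet transmission when $u$ users transmit; when $u=0$ all $d_i^k$ vanish and the sum over $k$ is taken to be $0$. A set function $G:2^S\to\mathbb R$ is submodular if $G(C\cup\{s\})-G(C)\le G(C'\cup\{s\})-G(C')$ for all $C'\subseteq C\subseteq S$ and $s\in S\setminus C$. *)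

theory Defs
  imports "HOL-Probability.Probability"
begin

definition submodular_on :: "'a set \<Rightarrow> ('a set \<Rightarrow> real) \<Rightarrow> bool" where
  "submodular_on S G \<longleftrightarrow>
     (\<forall>C C' s. C' \<subseteq> C \<longrightarrow> C \<subseteq> S \<longrightarrow> s \<in> S - C \<longrightarrow>
        G (C \<union> {s}) - G C \<le> G (C' \<union> {s}) - G C')"

definition zipf :: "nat \<Rightarrow> real \<Rightarrow> nat \<Rightarrow> real" where
  "zipf F \<gamma> i = real i powr (- \<gamma>) / (\<Sum>j=1..F. real j powr (- \<gamma>))"

text \<open>The Poisson weights are written out because the rate may be \<open>0\<close> (when \<open>\<eta> = 0\<close>),
  which the library's \<open>poisson_pmf\<close> excludes.\<close>

definition neighbor_prob :: "real \<Rightarrow> real \<Rightarrow> real \<Rightarrow> nat \<Rightarrow> real" where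
  "neighbor_prob \<eta> lam \<mu> n = (\<eta> * lam / \<mu>) ^ n * (exp (- (\<eta> * lam / \<mu>)) / fact n)"

text \<open>In the next two definitions \<open>\<rho> u\<close> is the conditional law of the random variable \<open>\<rho>\<close> given
  that \<open>u\<close> users transmit, so \<open>measure (\<rho> u) {\<tau><..}\<close> is the success probability
  \<open>\<P>[\<rho> > \<tau> | u]\<close>; \<open>b\<close> is the base of the logarithm.\<close>

definition rate_oma :: "(nat \<Rightarrow> real measure) \<Rightarrow> real \<Rightarrow> real \<Rightarrow> nat \<Rightarrow> real" where
  "rate_oma \<rho> \<tau> b u = 1 / real u * measure (\<rho> 1) {\<tau><..} * log b (1 + \<tau>)"

definition rate_noma :: "(nat \<Rightarrow> real measure) \<Rightarrow> real \<Rightarrow> real \<Rightarrow> nat \<Rightarrow> real" where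
  "rate_noma \<rho> \<tau> b u = measure (\<rho> u) {\<tau><..} * log b (1 + \<tau>)"

definition transmitting :: "nat \<Rightarrow> (nat \<Rightarrow> nat) \<Rightarrow> nat" where
  "transmitting n d = card {k \<in> {1..n}. d k \<noteq> 0}"

text \<open>The number of missing packets \<open>D(C\<^sub>i, u)\<close>, where \<open>c = |C\<^sub>i|\<close> and \<open>d k\<close> is the number of
  packets stored by user \<open>k\<close>. For \<open>u = 0\<close> the sum is \<open>0\<close> by convention, so \<open>R 0\<close> is never used.\<close>

definition missing_packets ::
  "nat \<Rightarrow> real \<Rightarrow> (nat \<Rightarrow> real) \<Rightarrow> nat \<Rightarrow> (nat \<Rightarrow> nat) \<Rightarrow> nat \<Rightarrow> int" where
  "missing_packets L \<mu> R n d c =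
     (let u = transmitting n d in
      max 0 (int L - int c -
        (if u = 0 then 0
         else (\<Sum>k=1..n. min (int (d k)) \<lfloor>real L / \<mu> * R u\<rfloor>))))"

text \<open>Here \<open>p i\<close> is the law of the number of packets of content \<open>i\<close> stored by a neighboring user,
  and \<open>S i\<close> is the set of the \<open>L\<close> elements belonging to content \<open>i\<close>.\<close>

definition caching_objective ::
  "nat \<Rightarrow> nat \<Rightarrow> real \<Rightarrow> real \<Rightarrow> real \<Rightarrow> real \<Rightarrow> (nat \<Rightarrow> nat pmf) \<Rightarrow> (nat \<Rightarrow> real)
    \<Rightarrow> (nat \<Rightarrow> 'a set) \<Rightarrow> 'a set \<Rightarrow> real" where
  "caching_objective F L \<gamma> \<eta> lam \<mu> p R S C =
     - (\<Sum>i=1..F. zipf F \<gamma> i *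
          (\<Sum>n. neighbor_prob \<eta> lam \<mu> n *
             (\<Sum>d \<in> {1..n} \<rightarrow>\<^sub>E {0..L}.
                (\<Prod>k=1..n. pmf (p i) (d k)) *
                real_of_int (missing_packets L \<mu> R n d (card (C \<inter> S i))))))"

end

theory Submission
  imports Defs
begin

text \<open>
  For fixed \<open>n\<close> and \<open>d\<close>, the number of missing packets is a function \<open>c \<mapsto> (a - c)\<^sup>+\<close> of \<open>c = |C\<^sub>i|\<close>,
  hence convex. Averaging with nonnegative weights preserves convexity, the series over \<open>n\<close>
  converging because the number of missing packets is at most \<open>L\<close>. Adding an element to \<open>C\<close>
  raises \<open>|C\<^sub>i|\<close> by one for the content it belongs to and changes nothing for the others, so
  the negative of a convex function of \<open>|C\<^sub>i|\<close> has diminishing returns.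
\<close>

text \<open>Increments are compared at two arbitrary points instead of consecutive ones, as
  submodularity compares the arbitrary sizes \<open>|C'| \<le> |C|\<close>. With no subtraction in
  it, the inequality can be summed termwise.\<close>

definition discrete_convex :: "(nat \<Rightarrow> real) \<Rightarrow> bool" where
  "discrete_convex g \<longleftrightarrow> (\<forall>c c'. c' \<le> c \<longrightarrow> g c + g (Suc c') \<le> g c' + g (Suc c))"

lemma discrete_convex_sum:
  assumes "\<And>d. d \<in> A \<Longrightarrow> discrete_convex (g d)" and "\<And>d. d \<in> A \<Longrightarrow> 0 \<le> w d"
  shows "discrete_convex (\<lambda>c. \<Sum>d\<in>A. w d * g d c)"
  unfolding discrete_convex_def
proof (intro allI impI)
  fix c c' :: nat
  assume "c' \<le> c"
  then show "(\<Sum>d\<in>A. w d * g d c) + (\<Sum>d\<in>A. w d * g d (Suc c'))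
      \<le> (\<Sum>d\<in>A. w d * g d c') + (\<Sum>d\<in>A. w d * g d (Suc c))"
    using assms unfolding discrete_convex_def sum.distrib[symmetric] distrib_left[symmetric]
    by (intro sum_mono mult_left_mono) auto
qed

text \<open>The inequality holds term by term. Summability is what allows the two series on each
  side to be merged and then compared termwise, since \<open>suminf\<close> says nothing about a
  divergent series.\<close>

lemma discrete_convex_suminf:
  assumes "\<And>n. discrete_convex (g n)" and "\<And>n. 0 \<le> w n"
    and summable: "\<And>c. summable (\<lambda>n. w n * g n c)"
  shows "discrete_convex (\<lambda>c. \<Sum>n. w n * g n c)"
  unfolding discrete_convex_def
proof (intro allI impI)
  fix c c' :: nat
  assume "c' \<le> c"
  then have "w n * g n c + w n * g n (Suc c') \<le> w n * g n c' + w n * g n (Suc c)" for n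
    using assms(1,2) unfolding discrete_convex_def distrib_left[symmetric]
    by (intro mult_left_mono) auto
  then show "(\<Sum>n. w n * g n c) + (\<Sum>n. w n * g n (Suc c'))
      \<le> (\<Sum>n. w n * g n c') + (\<Sum>n. w n * g n (Suc c))"
    using summable by (simp add: suminf_add suminf_le summable_add)
qed

lemma submodular_on_convex_card:
  fixes g :: "'i \<Rightarrow> nat \<Rightarrow> real"
  assumes convex: "\<And>i. i \<in> I \<Longrightarrow> discrete_convex (g i)"
    and "\<And>i. i \<in> I \<Longrightarrow> 0 \<le> w i"
    and fin: "\<And>i. i \<in> I \<Longrightarrow> finite (T i)"
  shows "submodular_on S (\<lambda>C. - (\<Sum>i\<in>I. w i * g i (card (C \<inter> T i))))"
  unfolding submodular_on_def
proof (intro allI impI)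
  fix C C' x
  assume C: "C' \<subseteq> C" and x: "x \<in> S - C"
  have "w i * g i (card (C \<inter> T i)) + w i * g i (card ((C' \<union> {x}) \<inter> T i))
      \<le> w i * g i (card (C' \<inter> T i)) + w i * g i (card ((C \<union> {x}) \<inter> T i))" if "i \<in> I" for i
  proof (cases "x \<in> T i")
    case True
    \<comment> \<open>Stated for all \<open>B \<subseteq> C\<close> to serve both \<open>C\<close>
      and \<open>C'\<close>: as \<open>x\<close> is outside \<open>C\<close>, it is new to either
      set.\<close>
    have card_insert: "card ((B \<union> {x}) \<inter> T i) = Suc (card (B \<inter> T i))" if "B \<subseteq> C" for B
    proof -
      have "x \<notin> B \<inter> T i" and "finite (B \<inter> T i)"
        using x that fin[OF \<open>i \<in> I\<close>] by auto
      with True show ?thesis by (simp add: Int_insert_left)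
    qed
    have "card (C' \<inter> T i) \<le> card (C \<inter> T i)"
      using C fin[OF that] by (intro card_mono) auto
    with convex[OF that] have "g i (card (C \<inter> T i)) + g i (Suc (card (C' \<inter> T i)))
        \<le> g i (card (C' \<inter> T i)) + g i (Suc (card (C \<inter> T i)))"
      unfolding discrete_convex_def by blast
    from mult_left_mono[OF this assms(2)[OF that]] show ?thesis
      unfolding card_insert[OF C] card_insert[OF order.refl] by (simp add: distrib_left)
  next
    case False
    then show ?thesis by (simp add: Int_insert_left)
  qed
  then have "(\<Sum>i\<in>I. w i * g i (card (C \<inter> T i))) + (\<Sum>i\<in>I. w i * g i (card ((C' \<union> {x}) \<inter> T i)))
      \<le> (\<Sum>i\<in>I. w i * g i (card (C' \<inter> T i))) + (\<Sum>i\<in>I. w i * g i (card ((C \<union> {x}) \<inter> T i)))"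
    unfolding sum.distrib[symmetric] by (intro sum_mono)
  then show "- (\<Sum>i\<in>I. w i * g i (card ((C \<union> {x}) \<inter> T i))) - - (\<Sum>i\<in>I. w i * g i (card (C \<inter> T i)))
      \<le> - (\<Sum>i\<in>I. w i * g i (card ((C' \<union> {x}) \<inter> T i))) - - (\<Sum>i\<in>I. w i * g i (card (C' \<inter> T i)))"
    by linarith
qed

text \<open>A maximum of two affine functions of \<open>c\<close> is convex.\<close>

lemma discrete_convex_pos_part: "discrete_convex (\<lambda>c. real_of_int (max 0 (m - int c - a)))"
  unfolding discrete_convex_def by auto

lemma discrete_convex_missing_packets:
  "discrete_convex (\<lambda>c. real_of_int (missing_packets L \<mu> R n d c))"
  unfolding missing_packets_def Let_def by (rule discrete_convex_pos_part)

lemma missing_packets_nonneg: "0 \<le> missing_packets L \<mu> R n d c"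
  by (simp add: missing_packets_def Let_def)

text \<open>A nonnegative rate makes the floor, hence every \<open>min\<close>, nonnegative, so
  neighbors can only reduce the number of missing packets. This bound is uniform in \<open>n\<close>
  and \<open>d\<close>.\<close>

lemma missing_packets_le:
  assumes "0 \<le> \<mu>" and "\<And>u. u \<ge> 1 \<Longrightarrow> 0 \<le> R u"
  shows "missing_packets L \<mu> R n d c \<le> int L"
proof -
  \<comment> \<open>The sign of \<open>R 0\<close> is unknown, so \<open>u = 0\<close> is left to
    the convention in the definition.\<close>
  have "0 \<le> (\<Sum>k=1..n. min (int (d k)) \<lfloor>real L / \<mu> * R u\<rfloor>)" if "u \<noteq> 0" for u
    using assms(1) assms(2)[of u] that by (intro sum_nonneg) auto
  then have "0 \<le> (if u = 0 then 0 else \<Sum>k=1..n. min (int (d k)) \<lfloor>real L / \<mu> * R u\<rfloor>)" for u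
    by simp
  from this[of "transmitting n d"] show ?thesis
    unfolding missing_packets_def Let_def by linarith
qed

text \<open>The sum factors into a power of a probability: that of \<open>card A\<close> independent
  draws all falling in \<open>B\<close>.\<close>

lemma sum_prod_pmf_le_1:
  assumes "finite A" and "finite B"
  shows "(\<Sum>d \<in> A \<rightarrow>\<^sub>E B. \<Prod>k\<in>A. pmf p (d k)) \<le> 1"
proof -
  have "(\<Sum>d \<in> A \<rightarrow>\<^sub>E B. \<Prod>k\<in>A. pmf p (d k)) = (\<Prod>k\<in>A. \<Sum>j\<in>B. pmf p j)"
    using assms by (simp only: prod_sum_PiE)
  also have "\<dots> = measure (measure_pmf p) B ^ card A"
    using assms(2) by (simp add: measure_measure_pmf_finite)
  also have "\<dots> \<le> 1"
    by (simp add: power_le_one)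
  finally show ?thesis .
qed

lemma neighbor_prob_nonneg:
  assumes "0 \<le> \<eta>" and "0 \<le> lam" and "0 \<le> \<mu>"
  shows "0 \<le> neighbor_prob \<eta> lam \<mu> n"
  using assms by (simp add: neighbor_prob_def)

lemma summable_neighbor_prob: "summable (neighbor_prob \<eta> lam \<mu>)"
proof -
  \<comment> \<open>A constant multiple of the exponential series, arranged in the form of
    \<open>summable_exp\<close>.\<close>
  have "neighbor_prob \<eta> lam \<mu>
      = (\<lambda>n. exp (- (\<eta> * lam / \<mu>)) * (inverse (fact n) * (\<eta> * lam / \<mu>) ^ n))"
    by (simp add: neighbor_prob_def fun_eq_iff field_simps)
  then show ?thesis
    by (simp only:) (intro summable_mult summable_exp)
qed

lemma discrete_convex_expected_missing_packets:
  assumes "0 \<le> \<eta>" and "0 \<le> lam" and "0 \<le> \<mu>" and "\<And>u. u \<ge> 1 \<Longrightarrow> 0 \<le> R u"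
  shows "discrete_convex (\<lambda>c. \<Sum>n. neighbor_prob \<eta> lam \<mu> n *
           (\<Sum>d \<in> {1..n} \<rightarrow>\<^sub>E {0..L}.
              (\<Prod>k=1..n. pmf q (d k)) * real_of_int (missing_packets L \<mu> R n d c)))"
    (is "discrete_convex (\<lambda>c. \<Sum>n. ?w n * ?D n c)")
proof (rule discrete_convex_suminf)
  show "discrete_convex (?D n)" for n
    by (intro discrete_convex_sum discrete_convex_missing_packets prod_nonneg) simp
  show w: "0 \<le> ?w n" for n
    using assms(1-3) by (rule neighbor_prob_nonneg)
  show "summable (\<lambda>n. ?w n * ?D n c)" for c
  proof (rule summable_comparison_test')
    \<comment> \<open>The majorant: \<open>?D n c\<close> lies between 0 and \<open>L\<close>, being
      a sum of values in that range with total weight at most 1.\<close>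
    show "summable (\<lambda>n. ?w n * real L)"
      by (intro summable_mult2 summable_neighbor_prob)
    fix n
    have "0 \<le> ?D n c"
      by (intro sum_nonneg mult_nonneg_nonneg prod_nonneg) (auto simp: missing_packets_nonneg)
    moreover have "?D n c \<le> (\<Sum>d \<in> {1..n} \<rightarrow>\<^sub>E {0..L}. (\<Prod>k=1..n. pmf q (d k)) * real L)"
    proof (intro sum_mono mult_left_mono prod_nonneg)
      fix d
      have "missing_packets L \<mu> R n d c \<le> int L"
        using assms(3,4) by (rule missing_packets_le)
      then show "real_of_int (missing_packets L \<mu> R n d c) \<le> real L"
        by linarith
    qed simp
    moreover have "\<dots> \<le> 1 * real L"
      unfolding sum_distrib_right[symmetric]
      by (intro mult_right_mono sum_prod_pmf_le_1) auto
    ultimately have "\<bar>?D n c\<bar> \<le> real L"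
      by linarith
    then show "norm (?w n * ?D n c) \<le> ?w n * real L"
      using w[of n] by (simp add: abs_mult mult_left_mono)
  qed
qed

lemma zipf_nonneg: "0 \<le> zipf F \<gamma> i"
  by (simp add: zipf_def sum_nonneg)

lemma rate_oma_nonneg: "0 \<le> \<tau> \<Longrightarrow> 1 < b \<Longrightarrow> 0 \<le> rate_oma \<rho> \<tau> b u"
  by (simp add: rate_oma_def)

lemma rate_noma_nonneg: "0 \<le> \<tau> \<Longrightarrow> 1 < b \<Longrightarrow> 0 \<le> rate_noma \<rho> \<tau> b u"
  by (simp add: rate_noma_def)

theorem proposition2:
  fixes F L :: nat
    and \<gamma> \<eta> lam \<mu> \<tau> b :: real
    and p :: "nat \<Rightarrow> nat pmf"
    and \<rho> :: "nat \<Rightarrow> real measure"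
    and R :: "nat \<Rightarrow> real"
    and s :: "nat \<Rightarrow> nat \<Rightarrow> 'a"
  assumes "F \<ge> 1" and "L \<ge> 1"
    and "\<gamma> \<ge> 0"
    and "lam > 0" and "\<mu> > 0"
    and "0 \<le> \<eta>" and "\<eta> \<le> 1"
    and "\<And>i. i \<in> {1..F} \<Longrightarrow> set_pmf (p i) \<subseteq> {0..L}"
    and "\<tau> > 0" and "b > 1"
    and "\<And>u. u \<ge> 1 \<Longrightarrow> real_distribution (\<rho> u)"
    and "(\<forall>u\<ge>1. R u = rate_oma \<rho> \<tau> b u) \<or> (\<forall>u\<ge>1. R u = rate_noma \<rho> \<tau> b u)"
    and "inj_on (\<lambda>(i, l). s i l) ({1..F} \<times> {1..L})"
  shows "submodular_on {s i l |i l. i \<in> {1..F} \<and> l \<in> {1..L}}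
           (caching_objective F L \<gamma> \<eta> lam \<mu> p R (\<lambda>i. {s i l |l. l \<in> {1..L}}))"
proof -
  \<comment> \<open>Under either access scheme, \<open>b > 1\<close> and \<open>\<tau> > 0\<close>
    make the logarithm nonnegative.\<close>
  have "0 \<le> R u" if "u \<ge> 1" for u
    using assms(12) that rate_oma_nonneg[of \<tau> b \<rho> u] rate_noma_nonneg[of \<tau> b \<rho> u] \<open>\<tau> > 0\<close> \<open>b > 1\<close>
    by auto
  then show ?thesis
    unfolding caching_objective_def using \<open>0 \<le> \<eta>\<close> \<open>lam > 0\<close> \<open>\<mu> > 0\<close>
    by (intro submodular_on_convex_card discrete_convex_expected_missing_packets zipf_nonneg) auto
qed

end
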